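(* Let $P$ be the transition matrix of an ergodic Markov chain on $[N]=\{1,\dots,N\}$, and run the RLGL algorithm with $P$ and a (deterministic or random) sequence $\mathbf{G}$ of green-light sets. Let $\pi_t,\pi'_t$ be the conditional distributions given $\mathbf{G}$ of the associated Markov chains $\mathbf{X}$ and $\mathbf{X}'$ (see context), and write $d_{TV}(X_t,X'_t):=d_{TV}(\pi_t,\pi'_t)$. Assume that there exist $\delta\in(0,1)$, $a>0$ and an increasing, possibly random, sequence of time instants $\mathbf{T}=\mathbf{T}(\delta)=(T_0=1,T_1,T_2,\dots)$ such that $$\mathbb{E}\left(d_{TV}(X_{T_n},X'_{T_n})\,\middle|\,\mathbf{T}\right)\le a\,\delta^n,\qquad n\ge 1 .$$ Let $\nu(t)$ be the number of instances $T_n$ on the interval $(0,t]$, formally defined as $$\nu(t)=\nu(t,\delta)=\sup\{n>0: T_n\le t\}$$ (with $\nu(t)=0$ if there is no such $n$). Then $$\mathbb{E}(\|C_t\|_1)\le 2a\,\mathbb{E}\left(\delta^{\nu(t)}\right),\qquad t\ge 0 .$$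
   Context: Ergodic means irreducible and aperiodic (finite state space). All vectors indexed by states are row vectors in $\mathbb{R}^N$; $\|\cdot\|_1$ is the sum of absolute values. RLGL algorithm. The input is a stochastic matrix $P$ and a sequence $\mathbf{G}=(G_0,G_1,\dots)$ of subsets of $[N]$ with $G_0=[N]$; the sets $G_t$, $t\ge1$, may be deterministic or random. For $G\subseteq[N]$ let $I(G)$ be the diagonal matrix with $I(G)_{ii}=1$ if $i\in G$ and all other entries $0$. Start with $C_0=\mathbf{0}$, $H_0=\mathbf{0}$, and $M_0$ a fixed probability distribution on $[N]$ (usually uniform). Recursively, $$M_t=C_tI(G_t)\ (t\ge1),\qquad H_{t+1}=H_t+M_t\ (t\ge0),\qquad C_{t+1}=C_t-M_t(I-P)\ (t\ge0).$$ Associated Markov chains. Let $P(G)=I-I(G)(I-P)$, the stochastic matrix whose rows $i\in G$ are those of $P$ and whose other rows are those of the identity matrix. Given $\mathbf{G}$, $\mathbf{X}=(X_0,X_1,\dots)$ is the inhomogeneous Markov chain with $X_0\sim M_0$ and transition matrix $P(G_t)$ from time $t$ to time $t+1$, $t\ge0$. Given $\mathbf{G}$, $\mathbf{X}'=(X'_0,X'_1,\dots)$ is the inhomogeneous Markov chain with $X'_0\sim M_0$, $X'_1=X'_0$, and transition matrix $P(G_t)$ from time $t$ to $t+1$ for $t\ge1$. Their distributions given $\mathbf{G}$ are $\pi_t$ and $\pi'_t$, i.e. $\pi_t=M_0P\prod_{k=1}^{t-1}P(G_k)$ and $\pi'_t=M_0\prod_{k=1}^{t-1}P(G_k)$ for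 $t\ge1$; they are random if $\mathbf{G}$ is random. The total variation distance is $d_{TV}(\pi,\pi')=\frac12\|\pi-\pi'\|_1$.
   Formalization: The bound E(d_TV(X_{T_n},X'_{T_n})|T) ≤ aδ^n is assumed also for n=0, i.e. d_TV(M_0P,M_0) ≤ a; with n≥1 only, the claim can fail at t=1, where ν(1)=0 and it says exactly this. "Increasing" is read as strictly increasing. *)

theory Defs
  imports "HOL-Probability.Probability"
begin

text \<open>The state space \<open>[N]\<close> is a finite index type \<open>'n\<close>. State-indexed vectors are row
  vectors, so a matrix acts from the right, by \<open>v*\<close>.\<close>

definition l1_norm :: "real^'n::finite \<Rightarrow> real" where
  "l1_norm x = (\<Sum>i\<in>UNIV. \<bar>x $ i\<bar>)"

definition d_TV :: "real^'n::finite \<Rightarrow> real^'n \<Rightarrow> real" where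
  "d_TV p q = 1/2 * l1_norm (p - q)"

definition prob_vec :: "real^'n::finite \<Rightarrow> bool" where
  "prob_vec m \<longleftrightarrow> (\<forall>i. 0 \<le> m $ i) \<and> (\<Sum>i\<in>UNIV. m $ i) = 1"

definition stochastic_mat :: "real^'n^'n::finite \<Rightarrow> bool" where
  "stochastic_mat P \<longleftrightarrow> (\<forall>i. prob_vec (P $ i))"

primrec mat_power :: "real^'n^'n::finite \<Rightarrow> nat \<Rightarrow> real^'n^'n" where
  "mat_power P 0 = mat 1"
| "mat_power P (Suc k) = mat_power P k ** P"

definition irreducible_mat :: "real^'n^'n::finite \<Rightarrow> bool" where
  "irreducible_mat P \<longleftrightarrow> (\<forall>i j. \<exists>k. 0 < mat_power P k $ i $ j)"

definition aperiodic_mat :: "real^'n^'n::finite \<Rightarrow> bool" where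
  "aperiodic_mat P \<longleftrightarrow> (\<forall>i. Gcd {k. 0 < k \<and> 0 < mat_power P k $ i $ i} = 1)"

definition ergodic_mat :: "real^'n^'n::finite \<Rightarrow> bool" where
  "ergodic_mat P \<longleftrightarrow> stochastic_mat P \<and> irreducible_mat P \<and> aperiodic_mat P"

definition sel_mat :: "'n::finite set \<Rightarrow> real^'n^'n" where
  "sel_mat G = (\<chi> i j. if i = j \<and> i \<in> G then 1 else 0)"

definition green_mat :: "real^'n^'n::finite \<Rightarrow> 'n set \<Rightarrow> real^'n^'n" where
  "green_mat P G = mat 1 - sel_mat G ** (mat 1 - P)"


subsection \<open>The RLGL algorithm\<close>

text \<open>The cash moved at time \<open>t\<close> when the current cash vector is \<open>c\<close>; at time \<open>0\<close> it is the
  given distribution \<open>M0\<close>, although the cash vector is then zero.\<close>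

definition moved_from :: "real^'n::finite \<Rightarrow> (nat \<Rightarrow> 'n set) \<Rightarrow> nat \<Rightarrow> real^'n \<Rightarrow> real^'n" where
  "moved_from M0 G t c = (if t = 0 then M0 else c v* sel_mat (G t))"

primrec rlgl_C :: "real^'n^'n::finite \<Rightarrow> real^'n \<Rightarrow> (nat \<Rightarrow> 'n set) \<Rightarrow> nat \<Rightarrow> real^'n" where
  "rlgl_C P M0 G 0 = 0"
| "rlgl_C P M0 G (Suc t) =
     rlgl_C P M0 G t - moved_from M0 G t (rlgl_C P M0 G t) v* (mat 1 - P)"

definition rlgl_M :: "real^'n^'n::finite \<Rightarrow> real^'n \<Rightarrow> (nat \<Rightarrow> 'n set) \<Rightarrow> nat \<Rightarrow> real^'n" where
  "rlgl_M P M0 G t = moved_from M0 G t (rlgl_C P M0 G t)"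

primrec rlgl_H :: "real^'n^'n::finite \<Rightarrow> real^'n \<Rightarrow> (nat \<Rightarrow> 'n set) \<Rightarrow> nat \<Rightarrow> real^'n" where
  "rlgl_H P M0 G 0 = 0"
| "rlgl_H P M0 G (Suc t) = rlgl_H P M0 G t + rlgl_M P M0 G t"


subsection \<open>The associated Markov chains\<close>

text \<open>Distribution at time \<open>t\<close> of the inhomogeneous chain with initial distribution \<open>m\<close> and
  transition matrix \<open>K t\<close> from time \<open>t\<close> to time \<open>t + 1\<close>.\<close>

primrec chain_dist :: "real^'n::finite \<Rightarrow> (nat \<Rightarrow> real^'n^'n) \<Rightarrow> nat \<Rightarrow> real^'n" where
  "chain_dist m K 0 = m"
| "chain_dist m K (Suc t) = chain_dist m K t v* K t"

definition dist_X :: "real^'n^'n::finite \<Rightarrow> real^'n \<Rightarrow> (nat \<Rightarrow> 'n set) \<Rightarrow> nat \<Rightarrow> real^'n" where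
  "dist_X P M0 G = chain_dist M0 (\<lambda>t. green_mat P (G t))"

text \<open>The identity matrix as the transition from time \<open>0\<close> to time \<open>1\<close> expresses
  \<open>X'\<^sub>1 = X'\<^sub>0\<close>.\<close>

definition dist_X' :: "real^'n^'n::finite \<Rightarrow> real^'n \<Rightarrow> (nat \<Rightarrow> 'n set) \<Rightarrow> nat \<Rightarrow> real^'n" where
  "dist_X' P M0 G = chain_dist M0 (\<lambda>t. if t = 0 then mat 1 else green_mat P (G t))"

text \<open>The closed forms of the two distributions, with the matrix product taken in increasing
  order of the index.\<close>

lemma sel_mat_UNIV: "sel_mat UNIV = mat 1"
  by (simp add: sel_mat_def mat_def)

lemma dist_X_closed_form:
  assumes "G 0 = UNIV"
  shows "dist_X P M0 G (Suc t) =
           (M0 v* P) v* foldl (**) (mat 1) (map (\<lambda>k. green_mat P (G k)) [1..<Suc t])"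
proof (induction t)
  case 0
  have "green_mat P UNIV = P"
    by (simp add: green_mat_def sel_mat_UNIV)
  then show ?case
    using assms by (simp add: dist_X_def)
next
  case (Suc t)
  then show ?case
    by (simp add: dist_X_def vector_matrix_mul_assoc matrix_mul_assoc)
qed

lemma dist_X'_closed_form:
  "dist_X' P M0 G (Suc t) =
     M0 v* foldl (**) (mat 1) (map (\<lambda>k. green_mat P (G k)) [1..<Suc t])"
proof (induction t)
  case 0
  show ?case
    by (simp add: dist_X'_def)
next
  case (Suc t)
  then show ?case
    by (simp add: dist_X'_def vector_matrix_mul_assoc matrix_mul_assoc)
qed


subsection \<open>Time instants\<close>

text \<open>On natural numbers \<open>Sup {} = 0\<close>, which is the convention wanted when no \<open>T n\<close> with
  \<open>n > 0\<close> lies in \<open>(0, t]\<close>. For strictly increasing \<open>T\<close> the set is finite.\<close>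

definition nu :: "(nat \<Rightarrow> nat) \<Rightarrow> nat \<Rightarrow> nat" where
  "nu T t = Sup {n. 0 < n \<and> T n \<le> t}"

text \<open>The \<open>\<sigma>\<close>-algebra generated by the whole random sequence \<open>T\<close>.\<close>

definition sigma_seq :: "'w measure \<Rightarrow> (nat \<Rightarrow> 'w \<Rightarrow> nat) \<Rightarrow> 'w measure" where
  "sigma_seq M T =
     vimage_algebra (space M) (\<lambda>\<omega> n. T n \<omega>) (Pi\<^sub>M UNIV (\<lambda>_. count_space UNIV))"

end

theory Submission
  imports Defs
begin

text \<open>The cash vector is the difference of the two chains, \<open>C\<^sub>t = \<pi>\<^sub>t - \<pi>'\<^sub>t\<close> for \<open>t \<ge> 1\<close>, because both
  sides start at \<open>M\<^sub>0P - M\<^sub>0\<close> and evolve by \<open>P(G\<^sub>t)\<close>. Stochastic matrices contract the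
  1-norm, so \<open>\<parallel>C\<^sub>t\<parallel>\<^sub>1\<close> is at most twice the total variation distance at the last
  instant \<open>T\<^sub>n \<le> t\<close>. The events \<open>\<nu>(t) = n\<close> belong to the \<open>\<sigma>\<close>-algebra of the instants, so the
  conditional bound may be integrated over each of them, and there are only finitely many.\<close>

section \<open>Contraction of the 1-norm under stochastic matrices\<close>

text \<open>The triangle inequality in each column and an exchange of sums leave the row sums of
  \<open>Q\<close>, which are 1.\<close>

lemma l1_norm_vector_stochastic_le:
  assumes "stochastic_mat Q"
  shows "l1_norm (x v* Q) \<le> l1_norm x"
proof -
  have nonneg: "0 \<le> Q $ i $ j" and row: "(\<Sum>j\<in>UNIV. Q $ i $ j) = 1" for i j
    using assms by (auto simp: stochastic_mat_def prob_vec_def)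
  have "l1_norm (x v* Q) = (\<Sum>j\<in>UNIV. \<bar>\<Sum>i\<in>UNIV. Q $ i $ j * x $ i\<bar>)"
    by (simp add: l1_norm_def vector_matrix_mult_def mult.commute)
  also have "\<dots> \<le> (\<Sum>j\<in>UNIV. \<Sum>i\<in>UNIV. Q $ i $ j * \<bar>x $ i\<bar>)"
    by (intro sum_mono order_trans[OF sum_abs]) (simp add: abs_mult nonneg)
  also have "\<dots> = (\<Sum>i\<in>UNIV. \<Sum>j\<in>UNIV. Q $ i $ j * \<bar>x $ i\<bar>)"
    by (rule sum.swap)
  also have "\<dots> = l1_norm x"
    by (simp add: l1_norm_def row flip: sum_distrib_right)
  finally show ?thesis .
qed

lemma sel_mat_mult_nth: "(sel_mat G ** A) $ i = (if i \<in> G then A $ i else 0)"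
  by (simp add: vec_eq_iff sel_mat_def matrix_matrix_mult_def if_distrib[where f="\<lambda>z. z * _"]
      sum.If_cases cong: if_cong)

text \<open>Each row is a row of \<open>P\<close> or of the identity, hence a probability
  vector.\<close>

lemma stochastic_green_mat:
  assumes "stochastic_mat P"
  shows "stochastic_mat (green_mat P G)"
proof -
  have "green_mat P G $ i = (if i \<in> G then P $ i else mat 1 $ i)" for i
    by (simp add: green_mat_def sel_mat_mult_nth)
  moreover have "prob_vec (mat 1 $ i)" for i :: 'a
    by (simp add: prob_vec_def mat_def)
  ultimately show ?thesis
    using assms by (simp add: stochastic_mat_def)
qed

section \<open>The cash vector and the two chains\<close>

text \<open>From time 1 on the moved cash is the green part of the current cash, so the update is
  linear in it. At time 0 the moved vector is \<open>M0\<close> although the cash is zero.\<close>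

lemma rlgl_C_Suc_green_mat:
  assumes "t \<ge> 1"
  shows "rlgl_C P M0 G (Suc t) = rlgl_C P M0 G t v* green_mat P (G t)"
  using assms
  by (simp add: moved_from_def green_mat_def vector_matrix_mult_diff_rdistrib
      flip: vector_matrix_mul_assoc)

lemma rlgl_C_eq_dist_diff:
  assumes "G 0 = UNIV" "t \<ge> 1"
  shows "rlgl_C P M0 G t = dist_X P M0 G t - dist_X' P M0 G t"
  using assms(2)
proof (induction t rule: dec_induct)
  case base
  \<comment> \<open>Since \<open>G 0\<close> is everything, the first transition of \<open>X\<close>
    is \<open>P\<close> and that of \<open>X'\<close> is the identity.\<close>
  show ?case
    by (simp add: assms(1) moved_from_def dist_X_def dist_X'_def green_mat_def sel_mat_UNIV
        vector_matrix_mult_diff_rdistrib)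
next
  case (step t)
  then show ?case
    using rlgl_C_Suc_green_mat[of t P M0 G]
    by (simp add: dist_X_def dist_X'_def vector_matrix_mult_diff_distrib del: rlgl_C.simps)
qed

lemma l1_norm_rlgl_C_antimono:
  assumes "stochastic_mat P" "1 \<le> s" "s \<le> t"
  shows "l1_norm (rlgl_C P M0 G t) \<le> l1_norm (rlgl_C P M0 G s)"
  using assms(3)
proof (induction t rule: dec_induct)
  case (step t)
  then show ?case
    using rlgl_C_Suc_green_mat[of t P M0 G] assms
      l1_norm_vector_stochastic_le[OF stochastic_green_mat[OF assms(1)]]
    by (metis order_trans)
qed simp

section \<open>Measurability\<close>

text \<open>There are only finitely many green sets, and for each fixed one the update is a
  continuous linear map of the previous cash vector.\<close>

lemma borel_measurable_rlgl_C:
  fixes G :: "nat \<Rightarrow> 'w \<Rightarrow> 'n::finite set"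
  assumes "\<And>k. G k \<in> measurable \<Omega> (count_space UNIV)"
  shows "(\<lambda>\<omega>. rlgl_C P M0 (\<lambda>k. G k \<omega>) t) \<in> borel_measurable \<Omega>"
proof (induction t)
  case (Suc t)
  have lin: "bounded_linear (\<lambda>x. x v* A)" for A :: "real^'n^'n"
  proof -
    have "(\<lambda>x. x v* A) = (*v) (transpose A)"
      by (simp add: fun_eq_iff)
    then show ?thesis
      by (simp only: matrix_vector_mul_bounded_linear)
  qed
  have step: "(\<lambda>\<omega>. rlgl_C P M0 (\<lambda>k. G k \<omega>) t v* sel_mat (G t \<omega>)) \<in> borel_measurable \<Omega>"
  proof (rule measurable_compose_countable[OF _ assms])
    show "(\<lambda>\<omega>. rlgl_C P M0 (\<lambda>k. G k \<omega>) t v* sel_mat S) \<in> borel_measurable \<Omega>" for S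
      using measurable_compose[OF Suc.IH borel_measurable_continuous_onI
          [OF linear_continuous_on[OF lin]]] .
  qed
  have "(\<lambda>\<omega>. moved_from M0 (\<lambda>k. G k \<omega>) t (rlgl_C P M0 (\<lambda>k. G k \<omega>) t) v* (mat 1 - P))
          \<in> borel_measurable \<Omega>"
  proof (cases "t = 0")
    case False
    then show ?thesis
      using measurable_compose[OF step borel_measurable_continuous_onI
          [OF linear_continuous_on[OF lin]]]
      by (simp add: moved_from_def)
  qed (simp add: moved_from_def)
  with Suc.IH show ?case
    by (simp add: borel_measurable_diff)
qed simp

lemma borel_measurable_l1_norm: "l1_norm \<in> borel_measurable borel"
  unfolding l1_norm_def by (intro borel_measurable_continuous_onI continuous_intros)

lemma measurable_sigma_seq:
  "T n \<in> measurable (sigma_seq M T) (count_space UNIV)"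
proof -
  have "(\<lambda>\<omega> n. T n \<omega>) \<in> measurable (sigma_seq M T) (Pi\<^sub>M UNIV (\<lambda>_. count_space UNIV))"
    unfolding sigma_seq_def by (rule measurable_vimage_algebra1) (simp add: space_PiM)
  then show ?thesis
    using measurable_component_singleton[of n UNIV "\<lambda>_. count_space UNIV"]
    by (auto dest: measurable_compose)
qed

text \<open>A sequence of measurable coordinates is a measurable map into the product space, so the
  preimages that form \<open>sigma_seq\<close> are events of \<open>M\<close>.\<close>

lemma subalgebra_sigma_seq:
  assumes "\<And>n. T n \<in> measurable M (count_space UNIV)"
  shows "subalgebra M (sigma_seq M T)"
proof -
  have "(\<lambda>\<omega> n. T n \<omega>) \<in> measurable M (Pi\<^sub>M UNIV (\<lambda>_. count_space UNIV))"
    using assms by (intro measurable_PiM_single') (auto simp: space_PiM)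
  then show ?thesis
    by (auto simp: subalgebra_def sigma_seq_def sets_vimage_algebra space_PiM
        intro!: sets.sigma_sets_subset measurable_sets)
qed

section \<open>The last instant up to time t\<close>

lemma nu_eqI:
  assumes "strict_mono T" "T n \<le> t" "t < T (Suc n)"
  shows "nu T t = n"
proof -
  have "{k. 0 < k \<and> T k \<le> t} = {0<..n}"
  proof (intro equalityI subsetI)
    fix k assume "k \<in> {k. 0 < k \<and> T k \<le> t}"
    then have "0 < k" "T k < T (Suc n)" using assms(3) by auto
    then show "k \<in> {0<..n}"
      using strict_mono_less[OF assms(1)] by (simp add: less_Suc_eq_le)
  next
    fix k assume "k \<in> {0<..n}"
    then show "k \<in> {k. 0 < k \<and> T k \<le> t}"
      using assms(2) strict_mono_less_eq[OF assms(1), of k n] by simp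
  qed
  then have "nu T t = Sup {0<..n}"
    by (simp only: nu_def)
  also have "\<dots> = n"
    \<comment> \<open>For \<open>n = 0\<close> the interval is empty and its supremum is 0 by
      convention.\<close>
    by (cases "n = 0") (simp_all add: cSup_eq_maximum)
  finally show ?thesis .
qed

text \<open>A strictly increasing sequence of naturals satisfies \<open>k \<le> T k\<close>, so a
  greatest index with \<open>T k \<le> t\<close> exists. The bound \<open>n \<le> t\<close> keeps
  the later sums over \<open>n\<close> finite.\<close>

lemma strict_mono_bracket:
  fixes T :: "nat \<Rightarrow> nat"
  assumes "strict_mono T" "T 0 \<le> t"
  obtains n where "n \<le> t" "T n \<le> t" "t < T (Suc n)"
proof -
  have bound: "k \<le> t" if "T k \<le> t" for k
    using strict_mono_imp_increasing[OF assms(1), of k] that by simp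
  define n where "n = (GREATEST k. T k \<le> t)"
  have "T n \<le> t"
    unfolding n_def using GreatestI_nat[of "\<lambda>k. T k \<le> t", OF assms(2)] bound by blast
  moreover have "\<not> T (Suc n) \<le> t"
    using Greatest_le_nat[of "\<lambda>k. T k \<le> t" "Suc n" t] bound unfolding n_def by fastforce
  ultimately show thesis
    using that bound by auto
qed

section \<open>Integration over the events on which \<open>nu\<close> is constant\<close>

text \<open>Over an event of \<open>F\<close>, a function and its conditional expectation have the
  same integral.\<close>

lemma (in prob_space) cond_exp_le_imp_set_integral_le:
  assumes sub: "subalgebra M F" and f: "integrable M f" and A: "A \<in> sets F"
    and le: "AE \<omega> in M. real_cond_exp M F f \<omega> \<le> c"
  shows "expectation (\<lambda>\<omega>. indicator A \<omega> * f \<omega>) \<le> expectation (\<lambda>\<omega>. indicator A \<omega> * c)"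
proof -
  interpret finite_measure_subalgebra M F
    by unfold_locales (rule sub)
  have A': "A \<in> sets M"
    using sub A by (auto simp: subalgebra_def)
  have "expectation (\<lambda>\<omega>. indicator A \<omega> * f \<omega>)
      = expectation (\<lambda>\<omega>. indicator A \<omega> * real_cond_exp M F f \<omega>)"
    using real_cond_exp_intA[OF f A] by (simp add: set_lebesgue_integral_def)
  also have "\<dots> \<le> expectation (\<lambda>\<omega>. indicator A \<omega> * c)"
  proof (rule integral_mono_AE)
    show "integrable M (\<lambda>\<omega>. indicator A \<omega> * real_cond_exp M F f \<omega>)"
      using integrable_mult_indicator[OF A' real_cond_exp_int(1)[OF f]] by simp
    show "integrable M (\<lambda>\<omega>. indicator A \<omega> * c)"
      using integrable_mult_indicator[OF A' integrable_const[of c]] by simp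
    show "AE \<omega> in M. indicator A \<omega> * real_cond_exp M F f \<omega> \<le> indicator A \<omega> * c"
      using le by eventually_elim (simp add: indicator_def)
  qed
  finally show ?thesis .
qed

theorem theorem8:
  fixes P :: "real^'n^'n::finite"
    and M0 :: "real^'n"
    and \<Omega> :: "'w measure"
    and G :: "nat \<Rightarrow> 'w \<Rightarrow> 'n set"
    and T :: "nat \<Rightarrow> 'w \<Rightarrow> nat"
    and \<delta> a :: real
    and t :: nat
  assumes "ergodic_mat P"
    and "prob_vec M0"
    and "prob_space \<Omega>"
    and "\<And>k. G k \<in> measurable \<Omega> (count_space UNIV)"
    and "\<And>\<omega>. \<omega> \<in> space \<Omega> \<Longrightarrow> G 0 \<omega> = UNIV"
    and "0 < \<delta>" and "\<delta> < 1" and "0 < a"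
    and "\<And>n. T n \<in> measurable \<Omega> (count_space UNIV)"
    and "\<And>\<omega>. \<omega> \<in> space \<Omega> \<Longrightarrow> T 0 \<omega> = 1"
    and "\<And>\<omega>. \<omega> \<in> space \<Omega> \<Longrightarrow> strict_mono (\<lambda>n. T n \<omega>)"
    and "\<And>n. AE \<omega> in \<Omega>.
           real_cond_exp \<Omega> (sigma_seq \<Omega> T)
             (\<lambda>\<omega>'. d_TV (dist_X P M0 (\<lambda>k. G k \<omega>') (T n \<omega>'))
                         (dist_X' P M0 (\<lambda>k. G k \<omega>') (T n \<omega>'))) \<omega>
           \<le> a * \<delta> ^ n"
  shows "prob_space.expectation \<Omega> (\<lambda>\<omega>. l1_norm (rlgl_C P M0 (\<lambda>k. G k \<omega>) t))
         \<le> 2 * a * prob_space.expectation \<Omega> (\<lambda>\<omega>. \<delta> ^ nu (\<lambda>n. T n \<omega>) t)"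
proof (cases "t = 0")
  \<comment> \<open>Here \<open>C\<^sub>0 = 0\<close>, and the right-hand side is
    nonnegative.\<close>
  case True
  then show ?thesis
    using assms by (simp add: l1_norm_def)
next
  case False
  interpret prob_space \<Omega> by fact
  have stoch: "stochastic_mat P"
    using assms(1) by (simp add: ergodic_mat_def)
  define L where "L s \<omega> = l1_norm (rlgl_C P M0 (\<lambda>k. G k \<omega>) s)" for s \<omega>
  define D where "D n \<omega> = d_TV (dist_X P M0 (\<lambda>k. G k \<omega>) (T n \<omega>))
                               (dist_X' P M0 (\<lambda>k. G k \<omega>) (T n \<omega>))" for n \<omega>
  \<comment> \<open>On \<open>A n\<close> the count \<open>nu\<close> equals \<open>n\<close>; the
    event involves the instants only, which puts it in \<open>sigma_seq\<close>.\<close>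
  define A where "A n = {\<omega> \<in> space (sigma_seq \<Omega> T). T n \<omega> \<le> t \<and> t < T (Suc n) \<omega>}" for n
  \<comment> \<open>This is the norm of the cash at time 1, which does not depend on
    \<open>G\<close>; by monotonicity it bounds all later norms and yields integrability.\<close>
  define K where "K = l1_norm (- (M0 v* (mat 1 - P)))"

  have spc: "space (sigma_seq \<Omega> T) = space \<Omega>"
    by (simp add: sigma_seq_def)
  have sub: "subalgebra \<Omega> (sigma_seq \<Omega> T)"
    by (rule subalgebra_sigma_seq) (rule assms)
  have A: "A n \<in> sets (sigma_seq \<Omega> T)" for n
  proof -
    note [measurable] = measurable_sigma_seq[of T _ \<Omega>]
    show ?thesis unfolding A_def by measurable
  qed
  then have A': "A n \<in> sets \<Omega>" for n
    using sub by (auto simp: subalgebra_def)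
  have nu_A: "nu (\<lambda>n. T n \<omega>) t = n" if "\<omega> \<in> A n" for n \<omega>
    using that assms(11) by (intro nu_eqI) (auto simp: A_def spc)
  have cover: "\<exists>n\<le>t. \<omega> \<in> A n" if \<omega>: "\<omega> \<in> space \<Omega>" for \<omega>
  proof -
    have "T 0 \<omega> \<le> t"
      using assms(10)[OF that] False by simp
    then obtain n where "n \<le> t" "T n \<omega> \<le> t" "t < T (Suc n) \<omega>"
      using strict_mono_bracket[of "\<lambda>n. T n \<omega>" t] assms(11)[OF \<omega>] by blast
    then show ?thesis
      using that by (auto simp: A_def spc)
  qed
  \<comment> \<open>The events \<open>A n\<close> with \<open>n \<le> t\<close> partition the space,
    so one summand survives. The function \<open>f\<close> is arbitrary because this serves both for
    the distances \<open>D\<close> and for the powers of \<delta>.\<close>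
  have ind: "(\<Sum>n\<le>t. indicator (A n) \<omega> * f n) = f (nu (\<lambda>n. T n \<omega>) t)"
    if \<omega>: "\<omega> \<in> space \<Omega>" for \<omega> and f :: "nat \<Rightarrow> real"
  proof -
    obtain m where m: "m \<le> t" "\<omega> \<in> A m"
      using cover[OF \<omega>] by blast
    have "(\<Sum>n\<le>t. indicator (A n) \<omega> * f n) = (\<Sum>n\<le>t. if n = m then f n else 0)"
      using m nu_A by (intro sum.cong) (auto simp: indicator_def)
    then show ?thesis
      using m nu_A by simp
  qed

  have L_meas: "L s \<in> borel_measurable \<Omega>" for s
    unfolding L_def
    using measurable_compose[OF borel_measurable_rlgl_C[of G \<Omega> P M0 s, OF assms(4)]
        borel_measurable_l1_norm] .
  have T_ge: "1 \<le> T n \<omega>" if "\<omega> \<in> space \<Omega>" for n \<omega>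
    using strict_mono_less_eq[OF assms(11)[OF that], of 0 n] assms(10)[OF that] by simp
  have L_nonneg: "0 \<le> L s \<omega>" for s \<omega>
    by (simp add: L_def l1_norm_def sum_nonneg)
  have L_le: "L s \<omega> \<le> K" if "1 \<le> s" for s \<omega>
    using l1_norm_rlgl_C_antimono[OF stoch order_refl that, of M0 "\<lambda>k. G k \<omega>"]
    by (simp add: L_def K_def moved_from_def)
  have D_eq: "2 * D n \<omega> = L (T n \<omega>) \<omega>" if "\<omega> \<in> space \<Omega>" for n \<omega>
    using rlgl_C_eq_dist_diff[of "\<lambda>k. G k \<omega>", OF assms(5)[OF that] T_ge[OF that]]
    by (simp add: D_def L_def d_TV_def)
  have L_int: "integrable \<Omega> (L t)"
    using L_meas L_le L_nonneg False
    by (intro integrable_const_bound[where B=K]) auto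
  have D_int: "integrable \<Omega> (D n)" for n
  proof -
    \<comment> \<open>The time index is random but takes countably many values.\<close>
    have "(\<lambda>\<omega>. L (T n \<omega>) \<omega>) \<in> borel_measurable \<Omega>"
      using L_meas assms(9) by (rule measurable_compose_countable)
    then have "integrable \<Omega> (\<lambda>\<omega>. L (T n \<omega>) \<omega>)"
      using L_le L_nonneg T_ge by (intro integrable_const_bound[where B=K]) auto
    then have "integrable \<Omega> (\<lambda>\<omega>. 1/2 * L (T n \<omega>) \<omega>)"
      by simp
    also have "?this \<longleftrightarrow> ?thesis"
      by (intro Bochner_Integration.integrable_cong refl) (simp flip: D_eq)
    finally show ?thesis .
  qed
  have ind_int: "integrable \<Omega> (\<lambda>\<omega>. indicator (A n) \<omega> * D n \<omega>)" for n
    using integrable_mult_indicator[OF A' D_int] by simp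

  have "expectation (L t) \<le> expectation (\<lambda>\<omega>. \<Sum>n\<le>t. 2 * (indicator (A n) \<omega> * D n \<omega>))"
  proof (rule integral_mono)
    fix \<omega> assume \<omega>: "\<omega> \<in> space \<Omega>"
    obtain m where m: "\<omega> \<in> A m"
      using cover[OF \<omega>] by blast
    have "L t \<omega> \<le> L (T m \<omega>) \<omega>"
      unfolding L_def using m by (intro l1_norm_rlgl_C_antimono stoch T_ge \<omega>) (simp add: A_def)
    also have "\<dots> = 2 * D (nu (\<lambda>n. T n \<omega>) t) \<omega>"
      using D_eq[OF \<omega>] nu_A[OF m] by simp
    also have "\<dots> = (\<Sum>n\<le>t. 2 * (indicator (A n) \<omega> * D n \<omega>))"
      using ind[OF \<omega>, of "\<lambda>n. D n \<omega>"] by (simp flip: sum_distrib_left)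
    finally show "L t \<omega> \<le> (\<Sum>n\<le>t. 2 * (indicator (A n) \<omega> * D n \<omega>))" .
  qed (use L_int ind_int in auto)
  also have "\<dots> = (\<Sum>n\<le>t. 2 * expectation (\<lambda>\<omega>. indicator (A n) \<omega> * D n \<omega>))"
    using ind_int by simp
  \<comment> \<open>The conditional bound enters here, one event at a time. The term
    \<open>n = 0\<close> accounts for the outcomes with \<open>t < T 1\<close> and uses the bound
    \<open>a\<close> at the instant \<open>T 0 = 1\<close>.\<close>
  also have "\<dots> \<le> (\<Sum>n\<le>t. 2 * expectation (\<lambda>\<omega>. indicator (A n) \<omega> * (a * \<delta> ^ n)))"
    using cond_exp_le_imp_set_integral_le[OF sub D_int A] assms(12)
    by (intro sum_mono mult_left_mono) (auto simp flip: D_def)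
  also have "\<dots> = expectation (\<lambda>\<omega>. \<Sum>n\<le>t. indicator (A n) \<omega> * (2 * a * \<delta> ^ n))"
    using A' by (subst Bochner_Integration.integral_sum)
      (auto simp: mult_ac emeasure_eq_measure intro!: integrable_mult_right)
  also have "\<dots> = expectation (\<lambda>\<omega>. 2 * a * \<delta> ^ nu (\<lambda>n. T n \<omega>) t)"
    by (intro Bochner_Integration.integral_cong refl ind)
  finally show ?thesis
    by (simp add: L_def[abs_def])
qed

end
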